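(* Let $P$ be a finite set of points of interest (POIs), let $R=\{r_0,r_1,\dots,r_k\}$ be a finite set of refueling stations disjoint from $P$ ($r_0$ being the base station), let $\bar R=R\setminus\{r_0\}$, let $V=P\cup R$, and let $E\subseteq\{(i,j)\in V\times V: i\neq j\}$ be the edge set of a directed graph $G=(V,E)$ without self-loops. Let $M$ be a finite set of unmanned vehicles (UVs). Let $f_{ij}\ge 0$ for $(i,j)\in E$, let $F_m,\delta_m$ be given for $m\in M$, let $q=|P|$, and let $e_j^m\in\mathbb{R}$ (incentives) be given for $j\in V$, $m\in M$. All sums $\sum_{j\in V}$ involving an edge index $(i,j)$ range over those $j$ with $(i,j)\in E$ (similarly for $(j,i)$). Suppose $(x,y,z)$, with $y_{ij}^m\in\{0,1\}$ and $x_{ij}^m\ge 0$ for $(i,j)\in E$, $m\in M$, and $z_r^m\in\{0,1\}$ for $r\in\bar R$, $m\in M$, satisfies the first-stage constraints: (i) $\sum_{i\in V}y_{ji}^m=\sum_{i\in V}y_{ij}^m$ for all $j\in V\setminus\{r_0\}$, $m\in M$; (ii) $\sum_{i\in V,m\in M}y_{ir_0}^m=|M|$ and $\sum_{i\in V,m\in M}y_{r_0i}^m=|M|$; (iii) $\sum_{(i,j)\in E:\,i\in S,\,j\notin S}y_{ij}^m\ge z_r^m$ for all $m\in M$, all $S\subset V\setminus\{r_0\}$ with $S\cap R\neq\emptyset$, and all $r\in S\cap R$; (iv) $\sum_{i\in V}y_{ri}^m\le q\,z_r^m$ for all $r\in\bar R$, $m\in M$; (v) $\sum_{i\in V,m\in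 M}y_{ij}^m\le 1$ and $\sum_{i\in V,m\in M}y_{ji}^m\le 1$ for all $j\in P$; (vi) $\sum_{j\in V}x_{ij}^m-\sum_{j\in V}x_{ji}^m=\sum_{j\in V}f_{ij}y_{ij}^m$ for all $i\in P$, $m\in M$; (vii) $x_{ri}^m=f_{ri}y_{ri}^m$ for all $i\in V$, $r\in R$, $m\in M$; (viii) $x_{ij}^m\le F_m y_{ij}^m$ for all $(i,j)\in E$, $m\in M$; (ix) $\sum_{(i,j)\in E}f_{ij}y_{ij}^m\le\delta_m$ for all $m\in M$. Let a scenario $\omega$ be given with availabilities $\alpha_m(\omega)\in\{0,1\}$, $m\in M$. Define $\phi^{ec}(x,y,\omega)$ as the optimal value of the problem: maximize $-\sum_{(i,j)\in E,\,m\in M}e_j^m v_{ij}^m(\omega)$ subject to (a) $\sum_{j\in V}f_{ij}v_{ij}^m(\omega)=\sum_{j\in V}x_{ij}^m-\sum_{j\in V}x_{ji}^m-\alpha_m(\omega)\sum_{j\in V}f_{ij}y_{ij}^m$ for all $i\in P$, $m\in M$; (b) $v_{ij}^m(\omega)\le y_{ij}^m$ for all $(i,j)\in E$, $m\in M$; (c) $f_{ri}v_{ri}^m(\omega)=x_{ri}^m-\alpha_m(\omega)f_{ri}y_{ri}^m$ for all $i\in V$, $r\in R$, $m\in M$; (d) $v_{ij}^m(\omega)\in\{0,1\}$ for all $(i,j)\in E$, $m\in M$; and define $\phi^{ec}_r(x,y,\omega)$ as the optimal value of the same problem with (d) replaced by $0\le v_{ij}^m(\omega)\le 1$. Then $\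phi^{ec}(x,y,\omega)=\phi^{ec}_r(x,y,\omega)$.
   Context: This is the second-stage (recourse) problem of a two-stage stochastic program for fuel-constrained UV mission planning with random UV availability. $y_{ij}^m=1$ means UV $m$ traverses edge $(i,j)$; $x_{ij}^m$ is a distance-flow variable; $z_r^m=1$ means UV $m$ uses refueling station $r$; $f_{ij}$ is the fuel/time consumed on edge $(i,j)$; $F_m$ is the fuel capacity and $\delta_m$ the maximum allowed distance of UV $m$; $\alpha_m(\omega)=1$ iff UV $m$ is available in scenario $\omega$. The claim is that the recourse problem has the same optimal value as its linear relaxation. *)

theory Defs
  imports Complex_Main "HOL-Library.Extended_Real"
begin

record ('v, 'm) uv_instance =
  pois :: "'v set"
  stations :: "'v set"
  base_station :: 'v
  edges :: "('v \<times> 'v) set"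
  uvs :: "'m set"
  fuel :: "'v \<Rightarrow> 'v \<Rightarrow> real"          \<comment> \<open>f\<close>
  fuel_capacity :: "'m \<Rightarrow> real"       \<comment> \<open>F\<close>
  max_distance :: "'m \<Rightarrow> real"        \<comment> \<open>\<delta>\<close>
  incentive :: "'v \<Rightarrow> 'm \<Rightarrow> real"     \<comment> \<open>e\<close>

definition verts :: "('v, 'm) uv_instance \<Rightarrow> 'v set" where
  "verts I = pois I \<union> stations I"

definition out_nbrs :: "('v, 'm) uv_instance \<Rightarrow> 'v \<Rightarrow> 'v set" where
  "out_nbrs I i = {j \<in> verts I. (i, j) \<in> edges I}"

definition in_nbrs :: "('v, 'm) uv_instance \<Rightarrow> 'v \<Rightarrow> 'v set" where
  "in_nbrs I i = {j \<in> verts I. (j, i) \<in> edges I}"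

definition wf_uv_instance :: "('v, 'm) uv_instance \<Rightarrow> bool" where
  "wf_uv_instance I \<longleftrightarrow>
     finite (pois I) \<and> finite (stations I) \<and> pois I \<inter> stations I = {} \<and>
     base_station I \<in> stations I \<and>
     edges I \<subseteq> {(i, j) \<in> verts I \<times> verts I. i \<noteq> j} \<and>
     finite (uvs I) \<and>
     (\<forall>(i, j) \<in> edges I. 0 \<le> fuel I i j)"

text \<open>
  A family indexed by edges and vehicles is a total function \<open>'v \<Rightarrow> 'v \<Rightarrow> 'm \<Rightarrow> real\<close>
  whose values off \<open>edges I\<close> and \<open>uvs I\<close> are never referred to: vertex sums range over
  neighbours only, and a constraint stated for a single pair of vertices is imposed only
  if that pair is an edge.
\<close>

definition first_stage_feasible ::
  "('v, 'm) uv_instance \<Rightarrow> ('v \<Rightarrow> 'v \<Rightarrow> 'm \<Rightarrow> real) \<Rightarrow> ('v \<Rightarrow> 'v \<Rightarrow> 'm \<Rightarrow> real) \<Rightarrow>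
   ('v \<Rightarrow> 'm \<Rightarrow> real) \<Rightarrow> bool" where
  "first_stage_feasible I x y z \<longleftrightarrow>
     (\<forall>(i, j) \<in> edges I. \<forall>m \<in> uvs I. y i j m \<in> {0, 1} \<and> 0 \<le> x i j m) \<and>
     (\<forall>r \<in> stations I - {base_station I}. \<forall>m \<in> uvs I. z r m \<in> {0, 1}) \<and>
     (\<forall>j \<in> verts I - {base_station I}. \<forall>m \<in> uvs I.
        (\<Sum>i\<in>out_nbrs I j. y j i m) = (\<Sum>i\<in>in_nbrs I j. y i j m)) \<and>
     (\<Sum>i\<in>in_nbrs I (base_station I). \<Sum>m\<in>uvs I. y i (base_station I) m)
        = real (card (uvs I)) \<and>
     (\<Sum>i\<in>out_nbrs I (base_station I). \<Sum>m\<in>uvs I. y (base_station I) i m)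
        = real (card (uvs I)) \<and>
     (\<forall>m \<in> uvs I. \<forall>S. S \<subseteq> verts I - {base_station I} \<and> S \<inter> stations I \<noteq> {} \<longrightarrow>
        (\<forall>r \<in> S \<inter> stations I.
           (\<Sum>(i, j)\<in>{(i, j) \<in> edges I. i \<in> S \<and> j \<notin> S}. y i j m) \<ge> z r m)) \<and>
     (\<forall>r \<in> stations I - {base_station I}. \<forall>m \<in> uvs I.
        (\<Sum>i\<in>out_nbrs I r. y r i m) \<le> real (card (pois I)) * z r m) \<and>
     (\<forall>j \<in> pois I.
        (\<Sum>i\<in>in_nbrs I j. \<Sum>m\<in>uvs I. y i j m) \<le> 1 \<and>
        (\<Sum>i\<in>out_nbrs I j. \<Sum>m\<in>uvs I. y j i m) \<le> 1) \<and>
     (\<forall>i \<in> pois I. \<forall>m \<in> uvs I.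
        (\<Sum>j\<in>out_nbrs I i. x i j m) - (\<Sum>j\<in>in_nbrs I i. x j i m)
          = (\<Sum>j\<in>out_nbrs I i. fuel I i j * y i j m)) \<and>
     (\<forall>r \<in> stations I. \<forall>i \<in> out_nbrs I r. \<forall>m \<in> uvs I.
        x r i m = fuel I r i * y r i m) \<and>
     (\<forall>(i, j) \<in> edges I. \<forall>m \<in> uvs I. x i j m \<le> fuel_capacity I m * y i j m) \<and>
     (\<forall>m \<in> uvs I. (\<Sum>(i, j)\<in>edges I. fuel I i j * y i j m) \<le> max_distance I m)"

definition recourse_constraints ::
  "('v, 'm) uv_instance \<Rightarrow> ('m \<Rightarrow> 'w \<Rightarrow> real) \<Rightarrow> ('v \<Rightarrow> 'v \<Rightarrow> 'm \<Rightarrow> real) \<Rightarrow>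
   ('v \<Rightarrow> 'v \<Rightarrow> 'm \<Rightarrow> real) \<Rightarrow> 'w \<Rightarrow> ('v \<Rightarrow> 'v \<Rightarrow> 'm \<Rightarrow> real) \<Rightarrow> bool" where
  "recourse_constraints I \<alpha> x y \<omega> v \<longleftrightarrow>
     (\<forall>i \<in> pois I. \<forall>m \<in> uvs I.
        (\<Sum>j\<in>out_nbrs I i. fuel I i j * v i j m)
          = (\<Sum>j\<in>out_nbrs I i. x i j m) - (\<Sum>j\<in>in_nbrs I i. x j i m)
            - \<alpha> m \<omega> * (\<Sum>j\<in>out_nbrs I i. fuel I i j * y i j m)) \<and>
     (\<forall>(i, j) \<in> edges I. \<forall>m \<in> uvs I. v i j m \<le> y i j m) \<and>
     (\<forall>r \<in> stations I. \<forall>i \<in> out_nbrs I r. \<forall>m \<in> uvs I.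
        fuel I r i * v r i m = x r i m - \<alpha> m \<omega> * fuel I r i * y r i m)"

definition recourse_objective ::
  "('v, 'm) uv_instance \<Rightarrow> ('v \<Rightarrow> 'v \<Rightarrow> 'm \<Rightarrow> real) \<Rightarrow> real" where
  "recourse_objective I v = - (\<Sum>(i, j)\<in>edges I. \<Sum>m\<in>uvs I. incentive I j m * v i j m)"

text \<open>
  Optimal values are suprema in \<open>ereal\<close>, so that they are meaningful without presupposing
  feasibility or boundedness (an infeasible maximisation problem has value \<open>-\<infinity>\<close>).
\<close>

definition phi_ec ::
  "('v, 'm) uv_instance \<Rightarrow> ('m \<Rightarrow> 'w \<Rightarrow> real) \<Rightarrow> ('v \<Rightarrow> 'v \<Rightarrow> 'm \<Rightarrow> real) \<Rightarrow>
   ('v \<Rightarrow> 'v \<Rightarrow> 'm \<Rightarrow> real) \<Rightarrow> 'w \<Rightarrow> ereal" where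
  "phi_ec I \<alpha> x y \<omega> =
     (SUP v \<in> {v. recourse_constraints I \<alpha> x y \<omega> v \<and>
                  (\<forall>(i, j) \<in> edges I. \<forall>m \<in> uvs I. v i j m \<in> {0, 1})}.
        ereal (recourse_objective I v))"

definition phi_ec_relaxed ::
  "('v, 'm) uv_instance \<Rightarrow> ('m \<Rightarrow> 'w \<Rightarrow> real) \<Rightarrow> ('v \<Rightarrow> 'v \<Rightarrow> 'm \<Rightarrow> real) \<Rightarrow>
   ('v \<Rightarrow> 'v \<Rightarrow> 'm \<Rightarrow> real) \<Rightarrow> 'w \<Rightarrow> ereal" where
  "phi_ec_relaxed I \<alpha> x y \<omega> =
     (SUP v \<in> {v. recourse_constraints I \<alpha> x y \<omega> v \<and>
                  (\<forall>(i, j) \<in> edges I. \<forall>m \<in> uvs I. 0 \<le> v i j m \<and> v i j m \<le> 1)}.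
        ereal (recourse_objective I v))"

end

theory Submission imports Defs begin

text \<open>
  Given (vi) and (vii), the recourse equalities say that on each departure from a vertex the
  weighted recourse \<open>f v\<close> equals \<open>(1 - \<alpha>) f y\<close>; at a POI this is an equation between sums, but
  by (v) at most one edge leaving it carries \<open>y = 1\<close>, so the sums have one nonzero term. Hence
  on edges with \<open>f \<noteq> 0\<close> every relaxed solution is already integral. An edge with \<open>f = 0\<close>
  occurs in no equality, so there \<open>v\<close> may be moved to an endpoint of \<open>[0, y]\<close>, chosen by the
  sign of the incentive so that the objective does not decrease.
\<close>

lemma sum_eq_single:
  fixes g :: "'a \<Rightarrow> 'b::comm_monoid_add"
  assumes "finite A" "a \<in> A" "\<And>b. b \<in> A \<Longrightarrow> b \<noteq> a \<Longrightarrow> g b = 0"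
  shows "sum g A = g a"
  using sum.mono_neutral_right[of A "{a}" g] assms by auto

lemma finite_out_nbrs: "wf_uv_instance I \<Longrightarrow> finite (out_nbrs I i)"
  by (simp add: wf_uv_instance_def out_nbrs_def verts_def)

lemma mem_out_nbrs_iff:
  assumes "wf_uv_instance I"
  shows "j \<in> out_nbrs I i \<longleftrightarrow> (i, j) \<in> edges I"
  using assms by (auto simp: wf_uv_instance_def out_nbrs_def)

lemma first_stage_feasibleD:
  assumes "first_stage_feasible I x y z"
  shows first_stage_y_01: "\<And>i j m. (i, j) \<in> edges I \<Longrightarrow> m \<in> uvs I \<Longrightarrow> y i j m \<in> {0, 1}"
    and first_stage_departure_le_1: "\<And>i. i \<in> pois I \<Longrightarrow>
      (\<Sum>j\<in>out_nbrs I i. \<Sum>m\<in>uvs I. y i j m) \<le> 1"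
    and first_stage_poi_flow: "\<And>i m. i \<in> pois I \<Longrightarrow> m \<in> uvs I \<Longrightarrow>
      (\<Sum>j\<in>out_nbrs I i. x i j m) - (\<Sum>j\<in>in_nbrs I i. x j i m)
        = (\<Sum>j\<in>out_nbrs I i. fuel I i j * y i j m)"
    and first_stage_station_flow: "\<And>r i m. r \<in> stations I \<Longrightarrow> i \<in> out_nbrs I r \<Longrightarrow> m \<in> uvs I \<Longrightarrow>
      x r i m = fuel I r i * y r i m"
proof -
  have y01: "\<forall>(i, j) \<in> edges I. \<forall>m \<in> uvs I. y i j m \<in> {0, 1} \<and> 0 \<le> x i j m"
    and le1: "\<forall>j \<in> pois I.
        (\<Sum>i\<in>in_nbrs I j. \<Sum>m\<in>uvs I. y i j m) \<le> 1 \<and>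
        (\<Sum>i\<in>out_nbrs I j. \<Sum>m\<in>uvs I. y j i m) \<le> 1"
    and poi: "\<forall>i \<in> pois I. \<forall>m \<in> uvs I.
        (\<Sum>j\<in>out_nbrs I i. x i j m) - (\<Sum>j\<in>in_nbrs I i. x j i m)
          = (\<Sum>j\<in>out_nbrs I i. fuel I i j * y i j m)"
    and station: "\<forall>r \<in> stations I. \<forall>i \<in> out_nbrs I r. \<forall>m \<in> uvs I.
        x r i m = fuel I r i * y r i m"
    using assms unfolding first_stage_feasible_def by - (elim conjE, assumption)+
  show "y i j m \<in> {0, 1}" if "(i, j) \<in> edges I" "m \<in> uvs I" for i j m
    using y01 that by blast
  show "(\<Sum>j\<in>out_nbrs I i. \<Sum>m\<in>uvs I. y i j m) \<le> 1" if "i \<in> pois I" for i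
    using le1 that by blast
  show "(\<Sum>j\<in>out_nbrs I i. x i j m) - (\<Sum>j\<in>in_nbrs I i. x j i m)
      = (\<Sum>j\<in>out_nbrs I i. fuel I i j * y i j m)" if "i \<in> pois I" "m \<in> uvs I" for i m
    using poi that by blast
  show "x r i m = fuel I r i * y r i m"
    if "r \<in> stations I" "i \<in> out_nbrs I r" "m \<in> uvs I" for r i m
    using station that by blast
qed

text \<open>Two departures with \<open>y = 1\<close> would already contribute 2 to the sum over all
  out-edges and vehicles in (v), whose remaining terms are nonnegative; the bound there is
  1.\<close>

lemma poi_departure_unique:
  assumes wf: "wf_uv_instance I" and fs: "first_stage_feasible I x y z"
    and i: "i \<in> pois I" and m: "m \<in> uvs I"
    and j: "j \<in> out_nbrs I i" "y i j m = 1"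
    and k: "k \<in> out_nbrs I i" "k \<noteq> j"
  shows "y i k m = 0"
proof (rule ccontr)
  assume "y i k m \<noteq> 0"
  moreover have y01: "y i l n \<in> {0, 1}" if "l \<in> out_nbrs I i" "n \<in> uvs I" for l n
    using first_stage_y_01[OF fs] that mem_out_nbrs_iff[OF wf] by blast
  ultimately have yk: "y i k m = 1"
    using k m by blast
  have y_nonneg: "0 \<le> y i l n" if "l \<in> out_nbrs I i" "n \<in> uvs I" for l n
    using y01[OF that] by auto
  have fin: "finite (uvs I)"
    using wf by (simp add: wf_uv_instance_def)
  have inner: "y i l m \<le> (\<Sum>n\<in>uvs I. y i l n)" if "l \<in> out_nbrs I i" for l
    by (rule member_le_sum[OF m]) (use y_nonneg that fin in auto)
  have "2 \<le> (\<Sum>n\<in>uvs I. y i j n) + (\<Sum>n\<in>uvs I. y i k n)"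
    using inner[OF j(1)] inner[OF k(1)] j yk by simp
  also have "\<dots> = (\<Sum>l\<in>{j, k}. \<Sum>n\<in>uvs I. y i l n)"
    using k by simp
  also have "\<dots> \<le> (\<Sum>l\<in>out_nbrs I i. \<Sum>n\<in>uvs I. y i l n)"
    by (rule sum_mono2) (use finite_out_nbrs[OF wf] j k y_nonneg in \<open>auto intro!: sum_nonneg\<close>)
  also have "\<dots> \<le> 1"
    using first_stage_departure_le_1[OF fs i] .
  finally show False by simp
qed

text \<open>This splits the aggregated equality at a POI into one equation per edge. The factor
  \<open>fuel I i j\<close> stays on both sides because \<open>v\<close> is not determined by these
  equalities on an edge without fuel cost.\<close>

lemma recourse_fuel_eq:
  assumes wf: "wf_uv_instance I" and fs: "first_stage_feasible I x y z"
    and rc: "recourse_constraints I \<alpha> x y \<omega> v"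
    and nonneg: "\<forall>(i, j) \<in> edges I. \<forall>m \<in> uvs I. 0 \<le> v i j m"
    and e: "(i, j) \<in> edges I" and m: "m \<in> uvs I"
  shows "fuel I i j * v i j m = (1 - \<alpha> m \<omega>) * (fuel I i j * y i j m)"
proof -
  have j: "j \<in> out_nbrs I i"
    using e mem_out_nbrs_iff[OF wf] by simp
  have v0: "v i k m = 0" if "k \<in> out_nbrs I i" "y i k m = 0" for k
  proof -
    have ik: "(i, k) \<in> edges I"
      using that mem_out_nbrs_iff[OF wf] by simp
    have "v i k m \<le> y i k m"
      using rc ik m unfolding recourse_constraints_def by blast
    moreover have "0 \<le> v i k m"
      using nonneg ik m by blast
    ultimately show ?thesis using that by simp
  qed
  \<comment> \<open>Disposing of \<open>y = 0\<close> first leaves \<open>y = 1\<close> at a POI, as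
    the uniqueness lemma requires. At a station the constraint is already given edge by
    edge.\<close>
  consider "y i j m = 0" | "y i j m = 1" "i \<in> pois I" | "i \<in> stations I"
    using first_stage_y_01[OF fs e m] e wf by (auto simp: wf_uv_instance_def verts_def)
  then show ?thesis
  proof cases
    case 1
    then show ?thesis using v0[OF j] by simp
  next
    case 2
    \<comment> \<open>All competing edges have \<open>y = 0\<close>, hence \<open>v = 0\<close> by
      \<open>v0\<close>, so both fuel sums collapse to their term at \<open>j\<close>.\<close>
    have y0: "y i k m = 0" if "k \<in> out_nbrs I i" "k \<noteq> j" for k
      using poi_departure_unique[OF wf fs 2(2) m j 2(1) that] .
    have "(\<Sum>k\<in>out_nbrs I i. fuel I i k * v i k m) = fuel I i j * v i j m"
      by (rule sum_eq_single[OF finite_out_nbrs[OF wf] j]) (simp add: v0 y0)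
    moreover have "(\<Sum>k\<in>out_nbrs I i. fuel I i k * y i k m) = fuel I i j * y i j m"
      by (rule sum_eq_single[OF finite_out_nbrs[OF wf] j]) (simp add: y0)
    moreover have "(\<Sum>k\<in>out_nbrs I i. x i k m) - (\<Sum>k\<in>in_nbrs I i. x k i m)
        = (\<Sum>k\<in>out_nbrs I i. fuel I i k * y i k m)"
      using first_stage_poi_flow[OF fs 2(2) m] .
    moreover have "(\<Sum>k\<in>out_nbrs I i. fuel I i k * v i k m)
        = (\<Sum>k\<in>out_nbrs I i. x i k m) - (\<Sum>k\<in>in_nbrs I i. x k i m)
          - \<alpha> m \<omega> * (\<Sum>k\<in>out_nbrs I i. fuel I i k * y i k m)"
      using rc 2 m unfolding recourse_constraints_def by blast
    ultimately show ?thesis by (simp add: left_diff_distrib)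
  next
    case 3
    have "fuel I i j * v i j m = x i j m - \<alpha> m \<omega> * fuel I i j * y i j m"
      using rc 3 j m unfolding recourse_constraints_def by blast
    moreover have "x i j m = fuel I i j * y i j m"
      using first_stage_station_flow[OF fs 3 j m] .
    ultimately show ?thesis by (simp add: left_diff_distrib)
  qed
qed

lemma relaxed_solution_rounding:
  assumes wf: "wf_uv_instance I" and fs: "first_stage_feasible I x y z"
    and \<alpha>: "\<forall>m \<in> uvs I. \<alpha> m \<omega> \<in> {0, 1}"
    and rc: "recourse_constraints I \<alpha> x y \<omega> v"
    and nonneg: "\<forall>(i, j) \<in> edges I. \<forall>m \<in> uvs I. 0 \<le> v i j m"
  obtains w where "recourse_constraints I \<alpha> x y \<omega> w"
    and "\<forall>(i, j) \<in> edges I. \<forall>m \<in> uvs I. w i j m \<in> {0, 1}"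
    and "recourse_objective I v \<le> recourse_objective I w"
proof
  \<comment> \<open>The objective is the negated incentive sum, so a positive incentive favours the
    lower endpoint 0. Otherwise the upper endpoint is taken; it is \<open>y\<close> rather than 1,
    to respect (b).\<close>
  define w where "w i j m =
    (if fuel I i j \<noteq> 0 then v i j m else if 0 < incentive I j m then 0 else y i j m)" for i j m
  have fw: "fuel I i j * w i j m = fuel I i j * v i j m" for i j m
    by (simp add: w_def)
  have vy: "v i j m \<le> y i j m" if "(i, j) \<in> edges I" "m \<in> uvs I" for i j m
    using rc that unfolding recourse_constraints_def by blast
  have v0: "0 \<le> v i j m" if "(i, j) \<in> edges I" "m \<in> uvs I" for i j m
    using nonneg that by blast
  have wy: "w i j m \<le> y i j m" if "(i, j) \<in> edges I" "m \<in> uvs I" for i j m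
    using vy[OF that] v0[OF that] by (simp add: w_def)
  \<comment> \<open>Constraints (a) and (c) see the solution only through its product with
    \<open>fuel\<close>, which \<open>fw\<close> shows unchanged; only (b) has to be checked
    anew.\<close>
  show "recourse_constraints I \<alpha> x y \<omega> w"
    using rc wy unfolding recourse_constraints_def fw by blast
  have w01: "w i j m \<in> {0, 1}" if e: "(i, j) \<in> edges I" and m: "m \<in> uvs I" for i j m
  proof (cases "fuel I i j = 0")
    case True
    then show ?thesis using first_stage_y_01[OF fs e m] by (simp add: w_def)
  next
    case False
    \<comment> \<open>Cancelling the nonzero fuel cost exhibits \<open>v\<close> as a product of two
      numbers in \<open>{0, 1}\<close>.\<close>
    then have "v i j m = (1 - \<alpha> m \<omega>) * y i j m"
      using recourse_fuel_eq[OF wf fs rc nonneg e m] by simp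
    moreover have "\<alpha> m \<omega> \<in> {0, 1}"
      using \<alpha> m by blast
    ultimately show ?thesis
      using first_stage_y_01[OF fs e m] False by (auto simp: w_def)
  qed
  then show "\<forall>(i, j) \<in> edges I. \<forall>m \<in> uvs I. w i j m \<in> {0, 1}"
    by blast
  \<comment> \<open>The comparison is made term by term, with the inequality reversed by the minus
    sign of the objective.\<close>
  have "incentive I j m * w i j m \<le> incentive I j m * v i j m"
    if "(i, j) \<in> edges I" "m \<in> uvs I" for i j m
    using v0[OF that] vy[OF that] by (auto simp: w_def intro: mult_left_mono_neg)
  then show "recourse_objective I v \<le> recourse_objective I w"
    unfolding recourse_objective_def by (auto intro!: sum_mono)
qed

theorem theorem1:
  fixes I :: "('v, 'm) uv_instance"
    and x y :: "'v \<Rightarrow> 'v \<Rightarrow> 'm \<Rightarrow> real"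
    and z :: "'v \<Rightarrow> 'm \<Rightarrow> real"
    and \<alpha> :: "'m \<Rightarrow> 'w \<Rightarrow> real"
    and \<omega> :: 'w
  assumes "wf_uv_instance I"
    and "first_stage_feasible I x y z"
    and "\<forall>m \<in> uvs I. \<alpha> m \<omega> \<in> {0, 1}"
  shows "phi_ec I \<alpha> x y \<omega> = phi_ec_relaxed I \<alpha> x y \<omega>"
proof (rule antisym)
  have "0 \<le> t \<and> t \<le> 1" if "t \<in> {0, 1}" for t :: real
    using that by auto
  then show "phi_ec I \<alpha> x y \<omega> \<le> phi_ec_relaxed I \<alpha> x y \<omega>"
    unfolding phi_ec_def phi_ec_relaxed_def by (intro SUP_subset_mono) blast+
  show "phi_ec_relaxed I \<alpha> x y \<omega> \<le> phi_ec I \<alpha> x y \<omega>"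
    unfolding phi_ec_def phi_ec_relaxed_def
  \<comment> \<open>Each relaxed solution is dominated by an integral one, so no optimum has to be
    attained, and an infeasible relaxation, of value \<open>-\<infinity>\<close>, is covered as
    well.\<close>
  proof (rule SUP_mono)
    fix v
    assume v: "v \<in> {v. recourse_constraints I \<alpha> x y \<omega> v \<and>
      (\<forall>(i, j) \<in> edges I. \<forall>m \<in> uvs I. 0 \<le> v i j m \<and> v i j m \<le> 1)}"
    then have "recourse_constraints I \<alpha> x y \<omega> v"
      and "\<forall>(i, j) \<in> edges I. \<forall>m \<in> uvs I. 0 \<le> v i j m"
      by blast+
    then obtain w where "recourse_constraints I \<alpha> x y \<omega> w"
      and "\<forall>(i, j) \<in> edges I. \<forall>m \<in> uvs I. w i j m \<in> {0, 1}"
      and "recourse_objective I v \<le> recourse_objective I w"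
      by (rule relaxed_solution_rounding[where \<alpha> = \<alpha> and \<omega> = \<omega>, OF assms])
    then show "\<exists>w \<in> {v. recourse_constraints I \<alpha> x y \<omega> v \<and>
        (\<forall>(i, j) \<in> edges I. \<forall>m \<in> uvs I. v i j m \<in> {0, 1})}.
        ereal (recourse_objective I v) \<le> ereal (recourse_objective I w)"
      by (intro bexI[of _ w]) simp_all
  qed
qed

end
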